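(* Let $m\ge0$ and $n\ge1$ be integers with $n\ge 2m$. Then the operator $\mathcal{B}_{2m}$ defined by $$\mathcal{B}_{2m}f(x,y,z)=\sum_{\nu=0}^{2m}\sum_{j=1}^{2m}\sum_{i=0}^{n-1}\mathcal{R}_{\phi_\nu}(f(\cdot,\cdot,z_i);\cos\theta_{j,2m})\,T_{\nu,j,i}(x,y,z),$$ $$T_{\nu,j,i}(x,y,z)=\frac{\sin\theta_{j,2m}}{n(2m+1)^2}\,\Phi_\nu(z_i,\cos\theta_{j,2m};x,y,z),$$ preserves polynomials of degree $2m-1$; that is, $\mathcal{B}_{2m}(f)=f$ whenever $f$ is a polynomial in three variables of total degree at most $2m-1$.
   Context: $L>0$, $B^2=\{(x,y)\in\mathbb{R}^2:x^2+y^2\le1\}$, $B_L=B^2\times[0,L]$. For fixed $w\in[0,L]$, $\mathcal{R}_\phi(f(\cdot,\cdot,w);t)$ is the Radon projection of $(x,y)\mapsto f(x,y,w)$, where for a function $g$ on $B^2$, $$\mathcal{R}_\phi(g;t)=\int_{-\sqrt{1-t^2}}^{\sqrt{1-t^2}}g(t\cos\phi-s\sin\phi,\ t\sin\phi+s\cos\phi)\,ds.$$ $\phi_\nu=\frac{2\pi\nu}{2m+1}$, $\theta_{j,2m}=\frac{j\pi}{2m+1}$, and $z_i=\frac L2\left(1+\cos\frac{(2i+1)\pi}{2n}\right)$, $0\le i\le n-1$ (the nodes of the $n$-point Gaussian quadrature for the weight $W_L(z)=\frac{1}{\pi\sqrt{z(L-z)}}$ on $[0,L]$). $U_k$ is the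 Chebyshev polynomial of the second kind, $U_k(\cos\theta)=\sin((k+1)\theta)/\sin\theta$, $U_k(\theta;x,y):=U_k(x\cos\theta+y\sin\theta)$; $T_k$ is the Chebyshev polynomial of the first kind, $T_k(\cos\theta)=\cos k\theta$; $\widetilde T_0(z)=1$ and $\widetilde T_k(z)=\sqrt2\,T_k(2z/L-1)$ for $k\ge1$ (the orthonormal polynomials for $W_L$). Finally $$\Phi_\nu(w,t;x,y,z)=\sum_{k=0}^{2m}(k+1)U_k(t)U_k(\phi_\nu;x,y)\sum_{l=0}^{2m-k}\widetilde T_l(w)\widetilde T_l(z).$$ The only polynomial of degree at most $-1$ is $0$. *)

theory Defs
  imports "HOL-Analysis.Analysis" "HOL-Computational_Algebra.Polynomial"
begin

text \<open>The Chebyshev polynomials of both kinds are the polynomials determined by the trigonometric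
  identities below; the two \<open>ex1\<close> lemmas justify the definite descriptions. They are
  polynomials, hence also defined for arguments outside \<open>[-1, 1]\<close>.\<close>

definition cheb_T :: "nat \<Rightarrow> real poly" where
  "cheb_T k = (THE p. \<forall>\<theta>. poly p (cos \<theta>) = cos (real k * \<theta>))"

definition cheb_U :: "nat \<Rightarrow> real poly" where
  "cheb_U k = (THE p. \<forall>\<theta>. sin \<theta> \<noteq> 0 \<longrightarrow> poly p (cos \<theta>) = sin ((real k + 1) * \<theta>) / sin \<theta>)"

lemma poly_eq_on_cos:
  fixes p q :: "real poly"
  assumes "\<And>\<theta>. sin \<theta> \<noteq> 0 \<Longrightarrow> poly p (cos \<theta>) = poly q (cos \<theta>)"
  shows "p = q"
proof (rule ccontr)
  assume "p \<noteq> q"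
  then have fin: "finite {x. poly (p - q) x = 0}"
    by (intro poly_roots_finite) simp
  have "{-1<..<1} \<subseteq> {x. poly (p - q) x = 0}"
  proof
    fix x :: real
    assume "x \<in> {-1<..<1}"
    then have x: "-1 < x" "x < 1" by auto
    then have "cos (arccos x) = x" "sin (arccos x) \<noteq> 0"
      using sin_arccos_nonzero[of x] by auto
    then show "x \<in> {x. poly (p - q) x = 0}"
      using assms[of "arccos x"] by simp
  qed
  then have "finite {-1<..<1::real}"
    using fin finite_subset by blast
  then show False using infinite_Ioo[of "-1::real" 1] by simp
qed

lemma ex1_cheb_T: "\<exists>!p::real poly. \<forall>\<theta>. poly p (cos \<theta>) = cos (real k * \<theta>)"
proof -
  have "\<exists>p::real poly. \<forall>\<theta>. poly p (cos \<theta>) = cos (real k * \<theta>)"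
  proof (induction k rule: induct_nat_012)
    case 0
    show ?case by (rule exI[of _ 1]) simp
  next
    case 1
    show ?case by (rule exI[of _ "[:0, 1:]"]) simp
  next
    case (ge2 k)
    then obtain p q :: "real poly" where
      p: "\<And>\<theta>. poly p (cos \<theta>) = cos (real k * \<theta>)" and
      q: "\<And>\<theta>. poly q (cos \<theta>) = cos (real (Suc k) * \<theta>)" by blast
    have "poly ([:0, 2:] * q - p) (cos \<theta>) = cos (real (Suc (Suc k)) * \<theta>)" for \<theta>
    proof -
      have "cos (real (Suc (Suc k)) * \<theta>) = cos (real (Suc k) * \<theta> + \<theta>)"
        and "cos (real k * \<theta>) = cos (real (Suc k) * \<theta> - \<theta>)"
        by (simp_all add: algebra_simps)
      then show ?thesis
        using p[of \<theta>] q[of \<theta>] by (simp add: cos_add cos_diff)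
    qed
    then show ?case by blast
  qed
  then show ?thesis
    by (metis poly_eq_on_cos)
qed

lemma ex1_cheb_U:
  "\<exists>!p::real poly. \<forall>\<theta>. sin \<theta> \<noteq> 0 \<longrightarrow> poly p (cos \<theta>) = sin ((real k + 1) * \<theta>) / sin \<theta>"
proof -
  have "\<exists>p::real poly. \<forall>\<theta>. poly p (cos \<theta>) * sin \<theta> = sin ((real k + 1) * \<theta>)"
  proof (induction k rule: induct_nat_012)
    case 0
    show ?case by (rule exI[of _ 1]) simp
  next
    case 1
    show ?case by (rule exI[of _ "[:0, 2:]"]) (simp add: sin_double)
  next
    case (ge2 k)
    then obtain p q :: "real poly" where
      p: "\<And>\<theta>. poly p (cos \<theta>) * sin \<theta> = sin ((real k + 1) * \<theta>)" and
      q: "\<And>\<theta>. poly q (cos \<theta>) * sin \<theta> = sin ((real (Suc k) + 1) * \<theta>)" by blast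
    have "poly ([:0, 2:] * q - p) (cos \<theta>) * sin \<theta> = sin ((real (Suc (Suc k)) + 1) * \<theta>)" for \<theta>
    proof -
      have *: "sin ((real (Suc (Suc k)) + 1) * \<theta>) = sin ((real (Suc k) + 1) * \<theta> + \<theta>)"
        "sin ((real k + 1) * \<theta>) = sin ((real (Suc k) + 1) * \<theta> - \<theta>)"
        by (simp_all add: algebra_simps)
      have "poly ([:0, 2:] * q - p) (cos \<theta>) * sin \<theta>
          = 2 * cos \<theta> * (poly q (cos \<theta>) * sin \<theta>) - poly p (cos \<theta>) * sin \<theta>"
        by (simp add: algebra_simps)
      also have "\<dots> = 2 * cos \<theta> * sin ((real (Suc k) + 1) * \<theta>) - sin ((real k + 1) * \<theta>)"
        by (simp only: p q)
      also have "\<dots> = sin ((real (Suc (Suc k)) + 1) * \<theta>)"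
        unfolding * by (simp only: sin_add sin_diff) simp
      finally show ?thesis .
    qed
    then show ?case by blast
  qed
  then have "\<exists>p::real poly. \<forall>\<theta>. sin \<theta> \<noteq> 0 \<longrightarrow> poly p (cos \<theta>) = sin ((real k + 1) * \<theta>) / sin \<theta>"
    by (metis nonzero_mult_div_cancel_right)
  then show ?thesis
    by (metis poly_eq_on_cos)
qed

lemma cheb_T_cos: "poly (cheb_T k) (cos \<theta>) = cos (real k * \<theta>)"
  using theI'[OF ex1_cheb_T[of k]] unfolding cheb_T_def by blast

lemma cheb_U_cos:
  "sin \<theta> \<noteq> 0 \<Longrightarrow> poly (cheb_U k) (cos \<theta>) = sin ((real k + 1) * \<theta>) / sin \<theta>"
  using theI'[OF ex1_cheb_U[of k]] unfolding cheb_U_def by blast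

definition U_ridge :: "nat \<Rightarrow> real \<Rightarrow> real \<Rightarrow> real \<Rightarrow> real" where
  "U_ridge k \<theta> x y = poly (cheb_U k) (x * cos \<theta> + y * sin \<theta>)"

definition T_tilde :: "real \<Rightarrow> nat \<Rightarrow> real \<Rightarrow> real" where
  "T_tilde L k z = (if k = 0 then 1 else sqrt 2 * poly (cheb_T k) (2 * z / L - 1))"

definition radon :: "real \<Rightarrow> (real \<Rightarrow> real \<Rightarrow> real) \<Rightarrow> real \<Rightarrow> real" where
  "radon \<phi> g t = integral {- sqrt (1 - t\<^sup>2)..sqrt (1 - t\<^sup>2)}
     (\<lambda>s. g (t * cos \<phi> - s * sin \<phi>) (t * sin \<phi> + s * cos \<phi>))"

definition phi_angle :: "nat \<Rightarrow> nat \<Rightarrow> real" where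
  "phi_angle m \<nu> = 2 * pi * real \<nu> / (2 * real m + 1)"

definition theta_angle :: "nat \<Rightarrow> nat \<Rightarrow> real" where
  "theta_angle m j = real j * pi / (2 * real m + 1)"

definition z_node :: "real \<Rightarrow> nat \<Rightarrow> nat \<Rightarrow> real" where
  "z_node L n i = L / 2 * (1 + cos ((2 * real i + 1) * pi / (2 * real n)))"

definition Phi :: "real \<Rightarrow> nat \<Rightarrow> nat \<Rightarrow> real \<Rightarrow> real \<Rightarrow> real \<Rightarrow> real \<Rightarrow> real \<Rightarrow> real" where
  "Phi L m \<nu> w t x y z =
     (\<Sum>k=0..2*m. (real k + 1) * poly (cheb_U k) t * U_ridge k (phi_angle m \<nu>) x y *
        (\<Sum>l=0..2*m-k. T_tilde L l w * T_tilde L l z))"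

definition T_kernel ::
    "real \<Rightarrow> nat \<Rightarrow> nat \<Rightarrow> nat \<Rightarrow> nat \<Rightarrow> nat \<Rightarrow> real \<Rightarrow> real \<Rightarrow> real \<Rightarrow> real" where
  "T_kernel L m n \<nu> j i x y z =
     sin (theta_angle m j) / (real n * (2 * real m + 1)\<^sup>2) *
       Phi L m \<nu> (z_node L n i) (cos (theta_angle m j)) x y z"

definition B_op ::
    "real \<Rightarrow> nat \<Rightarrow> nat \<Rightarrow> (real \<Rightarrow> real \<Rightarrow> real \<Rightarrow> real) \<Rightarrow> real \<Rightarrow> real \<Rightarrow> real \<Rightarrow> real" where
  "B_op L m n f x y z =
     (\<Sum>\<nu>=0..2*m. \<Sum>j=1..2*m. \<Sum>i<n.
        radon (phi_angle m \<nu>) (\<lambda>u v. f u v (z_node L n i)) (cos (theta_angle m j)) *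
        T_kernel L m n \<nu> j i x y z)"

text \<open>Polynomials in three real variables of total degree at most \<open>d\<close>. The bound is an integer so
  that \<open>d = -1\<close> is allowed: the index set is then empty and \<open>poly3 (-1)\<close> consists of the zero
  function only. As \<open>a, b, c\<close> are natural numbers, the index set is always finite.\<close>

definition poly3 :: "int \<Rightarrow> (real \<Rightarrow> real \<Rightarrow> real \<Rightarrow> real) set" where
  "poly3 d = {f. \<exists>coef :: nat \<Rightarrow> nat \<Rightarrow> nat \<Rightarrow> real. \<forall>x y z.
     f x y z = (\<Sum>(a, b, c) \<in> {(a, b, c). int a + int b + int c \<le> d}.
                  coef a b c * x ^ a * y ^ b * z ^ c)}"

lemma finite_poly3_index:
  "finite {(a::nat, b::nat, c::nat). int a + int b + int c \<le> d}"
  by (rule finite_subset[of _ "{..nat d} \<times> {..nat d} \<times> {..nat d}"]) auto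

end

theory Submission
  imports Defs
begin

text \<open>By linearity it suffices to treat a spanning family, and products
  \<open>U\<^sub>d(x cos \<eta> + y sin \<eta>) T\<^sub>c(2z/L - 1)\<close> with \<open>d + c < 2m\<close> are adapted to the operator. The Radon
  projection of such a ridge polynomial at \<open>t = cos \<theta>\<close> is
  \<open>2/(d+1) sin((d+1)\<theta>) U\<^sub>d(cos(\<phi> - \<eta>))\<close> (Marr). Hence the sum over the nodes \<open>z\<^sub>i\<close> selects
  \<open>l = c\<close>, the sum over the angles \<open>\<theta>\<^sub>j\<close> selects \<open>k = d\<close> by discrete orthogonality of sines, and the
  truncation \<open>l \<le> 2m - k\<close> is harmless because \<open>c \<le> 2m - d\<close>. The remaining sum over \<open>\<phi>\<^sub>\<nu>\<close> reproduces
  trigonometric polynomials with frequencies \<open>d, d - 2, \<dots>, -d\<close>: only even frequencies of modulus at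
  most \<open>2d\<close> occur in the products, and the nonzero ones do not alias modulo the odd number \<open>2m + 1\<close>.\<close>

section \<open>Discrete cosine and sine sums\<close>

lemma sum_cos_arith:
  "2 * sin (a / 2) * (\<Sum>i<n. cos (a * real i + c)) = sin (a * real n - a / 2 + c) - sin (c - a / 2)"
proof (induction n)
  case 0
  show ?case by simp
next
  case (Suc n)
  \<comment> \<open>The factor \<open>2 * sin (a / 2)\<close> turns every summand into a difference
    of sines at consecutive half steps, so the sum telescopes.\<close>
  have "2 * sin (a / 2) * cos (a * real n + c)
      = sin (a * real n + c + a / 2) - sin (a * real n + c - a / 2)"
    by (simp add: sin_add sin_diff)
  also have "a * real n + c + a / 2 = a * real (Suc n) - a / 2 + c"
    by (simp add: field_simps)
  also have "a * real n + c - a / 2 = a * real n - a / 2 + c"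
    by simp
  finally show ?case
    using Suc by (simp add: algebra_simps)
qed

lemma sin_pi_fraction_nonzero:
  fixes k :: int
  assumes "\<not> int N dvd k" "N > 0"
  shows "sin (of_int k * pi / real N) \<noteq> 0"
proof
  assume "sin (of_int k * pi / real N) = 0"
  then obtain i :: int where "of_int k * pi / real N = of_int i * pi"
    using sin_zero_iff_int2 by blast
  then have "of_int k = (of_int (i * int N) :: real)"
    using assms(2) by (simp add: field_simps)
  then have "k = i * int N"
    by (simp only: of_int_eq_iff)
  with assms(1) show False by simp
qed

text \<open>Over a full period the two ends of the telescoped sum agree, while the factor
  \<open>sin (a / 2)\<close> is nonzero because \<open>k\<close> is not a multiple of
  \<open>N\<close>.\<close>

lemma sum_cos_full_period:
  fixes k :: int
  assumes "\<not> int N dvd k" "N > 0"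
  shows "(\<Sum>i<N. cos (2 * pi * of_int k / real N * real i + c)) = 0"
proof -
  let ?a = "2 * pi * of_int k / real N"
  have "sin (?a * real N - ?a / 2 + c) = sin (c - ?a / 2 + of_int k * (2 * pi))"
    using assms(2) by (simp add: algebra_simps)
  also have "\<dots> = sin (c - ?a / 2)"
    using sin_int_2pin[of k] cos_int_2pin[of k] by (simp add: sin_add mult.commute)
  finally have "2 * sin (?a / 2) * (\<Sum>i<N. cos (?a * real i + c)) = 0"
    using sum_cos_arith[of ?a c N] by simp
  moreover have "sin (?a / 2) \<noteq> 0"
    using sin_pi_fraction_nonzero[OF assms] by (simp add: mult.commute)
  ultimately show ?thesis by simp
qed

text \<open>The value depends only on the parity of \<open>k\<close>. Hence the sums for
  \<open>p - q\<close> and \<open>p + q\<close>, which have equal parity, cancel in the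
  orthogonality of sines.\<close>

lemma sum_cos_half_period:
  fixes k :: int
  assumes "\<not> 2 * int N dvd k" "N > 0"
  shows "(\<Sum>i<N. cos (of_int k * pi / real N * real i)) = (1 - cos (of_int k * pi)) / 2"
proof -
  let ?a = "of_int k * pi / real N"
  have "sin (?a * real N - ?a / 2 + 0) = - (cos (of_int k * pi) * sin (?a / 2))"
    using assms(2) sin_zero_iff_int2[of "of_int k * pi"] by (simp add: sin_diff)
  then have "2 * sin (?a / 2) * (\<Sum>i<N. cos (?a * real i)) = sin (?a / 2) * (1 - cos (of_int k * pi))"
    using sum_cos_arith[of ?a 0 N] by (simp add: algebra_simps)
  moreover have "sin (?a / 2) \<noteq> 0"
    using sin_pi_fraction_nonzero[of "2 * N" k] assms by (simp add: mult.commute)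
  ultimately show ?thesis by simp
qed

text \<open>The bounds are asymmetric because the kernel degree \<open>k = 2 * m\<close> leads to
  \<open>q = N\<close>, where every summand is zero. They give \<open>p + q < 2 * N\<close>, which
  excludes aliasing.\<close>

lemma sin_discrete_orthogonality:
  assumes "0 < p" "p < N" "0 < q" "q \<le> N"
  shows "(\<Sum>j<N. sin (real p * (real j * pi / real N)) * sin (real q * (real j * pi / real N)))
    = (if p = q then real N / 2 else 0)"
proof -
  let ?c = "\<lambda>k::int. \<Sum>j<N. cos (of_int k * pi / real N * real j)"
  have N: "N > 0" using assms by simp
  have "(\<Sum>j<N. sin (real p * (real j * pi / real N)) * sin (real q * (real j * pi / real N)))
      = (?c (int p - int q) - ?c (int p + int q)) / 2"
    unfolding sum_subtractf[symmetric] sum_divide_distrib sin_times_sin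
    by (rule sum.cong) (simp_all add: algebra_simps add_divide_distrib diff_divide_distrib)
  moreover have "\<not> 2 * int N dvd int p + int q"
    using assms zdvd_imp_le[of "2 * int N" "int p + int q"] by auto
  then have plus: "?c (int p + int q) = (1 - cos (of_int (int p + int q) * pi)) / 2"
    by (rule sum_cos_half_period[OF _ N])
  moreover have "?c (int p - int q) = (1 - cos (of_int (int p + int q) * pi)) / 2" if "p \<noteq> q"
  proof -
    have "\<not> 2 * int N dvd int p - int q"
    proof
      assume "2 * int N dvd int p - int q"
      then have "2 * int N dvd \<bar>int p - int q\<bar>" by simp
      then show False
        using assms that zdvd_imp_le[of "2 * int N" "\<bar>int p - int q\<bar>"] by auto
    qed
    then have "?c (int p - int q) = (1 - cos (of_int (int p - int q) * pi)) / 2"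
      by (rule sum_cos_half_period[OF _ N])
    also have "cos (of_int (int p - int q) * pi) = cos (of_int (int p + int q) * pi)"
      by (simp add: algebra_simps cos_add cos_diff)
    finally show ?thesis .
  qed
  \<comment> \<open>For \<open>p = q\<close> the sum of frequency \<open>p + q\<close> is thus zero,
    and the one of frequency zero is \<open>N\<close>.\<close>
  moreover have "cos (of_int (int p + int p) * pi) = 1"
    using cos_int_2pin[of "int p"] by (simp add: algebra_simps)
  ultimately show ?thesis
    by auto
qed

text \<open>The midpoint offset \<open>a / 2\<close> makes the telescoped ends
  \<open>sin (r * pi)\<close> and \<open>sin 0\<close>, both zero for every integer
  \<open>r\<close>.\<close>

lemma sum_cos_midpoint:
  fixes r :: int
  assumes "\<not> 2 * int n dvd r" "n > 0"
  shows "(\<Sum>i<n. cos (of_int r * ((2 * real i + 1) * pi / (2 * real n)))) = 0"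
proof -
  let ?a = "of_int r * pi / real n"
  have "(\<Sum>i<n. cos (of_int r * ((2 * real i + 1) * pi / (2 * real n))))
      = (\<Sum>i<n. cos (?a * real i + ?a / 2))"
    by (rule sum.cong) (use assms in \<open>simp_all add: field_simps\<close>)
  moreover have "2 * sin (?a / 2) * (\<Sum>i<n. cos (?a * real i + ?a / 2)) = 0"
    using sum_cos_arith[of ?a "?a / 2" n] assms(2) sin_zero_iff_int2[of "of_int r * pi"] by simp
  moreover have "sin (?a / 2) \<noteq> 0"
    using sin_pi_fraction_nonzero[of "2 * n" r] assms by (simp add: mult.commute)
  ultimately show ?thesis by simp
qed

section \<open>Identities for Chebyshev polynomials\<close>

lemma cheb_U_cos_mult_sin: "poly (cheb_U k) (cos \<theta>) * sin \<theta> = sin ((real k + 1) * \<theta>)"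
proof (cases "sin \<theta> = 0")
  case True
  \<comment> \<open>Where the sine vanishes, both sides are zero, so the identity cleared of its
    denominator holds at every angle.\<close>
  then obtain i :: int where "\<theta> = of_int i * pi"
    using sin_zero_iff_int2 by blast
  then have "(real k + 1) * \<theta> = of_int ((int k + 1) * i) * pi"
    by simp
  then have "sin ((real k + 1) * \<theta>) = 0"
    using sin_zero_iff_int2 by blast
  with True show ?thesis by simp
next
  case False
  then show ?thesis by (simp add: cheb_U_cos)
qed

lemma cheb_T_0: "cheb_T 0 = 1"
  by (rule poly_eq_on_cos) (simp add: cheb_T_cos)

lemma cheb_T_1: "cheb_T (Suc 0) = [:0, 1:]"
  by (rule poly_eq_on_cos) (simp add: cheb_T_cos)

lemma cheb_T_rec: "cheb_T (Suc (Suc k)) = [:0, 2:] * cheb_T (Suc k) - cheb_T k"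
proof (rule poly_eq_on_cos)
  fix \<theta> :: real
  have "real (Suc (Suc k)) * \<theta> = real (Suc k) * \<theta> + \<theta>" "real k * \<theta> = real (Suc k) * \<theta> - \<theta>"
    by (simp_all add: algebra_simps)
  then show "poly (cheb_T (Suc (Suc k))) (cos \<theta>) = poly ([:0, 2:] * cheb_T (Suc k) - cheb_T k) (cos \<theta>)"
    by (simp add: cheb_T_cos cos_add cos_diff del: of_nat_Suc)
qed

lemma cheb_U_eqI:
  assumes "\<And>\<theta>. poly p (cos \<theta>) * sin \<theta> = sin ((real k + 1) * \<theta>)"
  shows "cheb_U k = p"
proof (rule poly_eq_on_cos)
  fix \<theta> :: real
  assume "sin \<theta> \<noteq> 0"
  moreover have "poly (cheb_U k) (cos \<theta>) * sin \<theta> = poly p (cos \<theta>) * sin \<theta>"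
    by (simp add: assms cheb_U_cos_mult_sin)
  ultimately show "poly (cheb_U k) (cos \<theta>) = poly p (cos \<theta>)" by simp
qed

lemma cheb_U_0: "cheb_U 0 = 1"
  by (rule cheb_U_eqI) simp

lemma cheb_U_1: "cheb_U (Suc 0) = [:0, 2:]"
  by (rule cheb_U_eqI) (simp add: sin_double)

lemma cheb_U_rec: "cheb_U (Suc (Suc k)) = [:0, 2:] * cheb_U (Suc k) - cheb_U k"
proof (rule cheb_U_eqI)
  fix \<theta> :: real
  let ?b = "(real (Suc k) + 1) * \<theta>"
  have *: "(real (Suc (Suc k)) + 1) * \<theta> = ?b + \<theta>" "(real k + 1) * \<theta> = ?b - \<theta>"
    by (simp_all add: algebra_simps)
  have "poly ([:0, 2:] * cheb_U (Suc k) - cheb_U k) (cos \<theta>) * sin \<theta>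
      = 2 * cos \<theta> * (poly (cheb_U (Suc k)) (cos \<theta>) * sin \<theta>) - poly (cheb_U k) (cos \<theta>) * sin \<theta>"
    by (simp add: algebra_simps)
  also have "\<dots> = sin (?b + \<theta>)"
    unfolding cheb_U_cos_mult_sin *(2) by (simp add: sin_add sin_diff)
  finally show "poly ([:0, 2:] * cheb_U (Suc k) - cheb_U k) (cos \<theta>) * sin \<theta>
      = sin ((real (Suc (Suc k)) + 1) * \<theta>)"
    unfolding *(1) .
qed

lemma cheb_U_eq_add_cheb_T: "cheb_U (Suc (Suc k)) = cheb_U k + 2 * cheb_T (Suc (Suc k))"
proof (rule cheb_U_eqI)
  fix \<theta> :: real
  let ?b = "real (Suc (Suc k)) * \<theta>"
  have *: "(real (Suc (Suc k)) + 1) * \<theta> = ?b + \<theta>" "(real k + 1) * \<theta> = ?b - \<theta>"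
    by (simp_all add: algebra_simps)
  have "poly (cheb_U k + 2 * cheb_T (Suc (Suc k))) (cos \<theta>) * sin \<theta>
      = poly (cheb_U k) (cos \<theta>) * sin \<theta> + 2 * cos ?b * sin \<theta>"
    by (simp add: algebra_simps cheb_T_cos)
  also have "\<dots> = sin (?b + \<theta>)"
    unfolding cheb_U_cos_mult_sin *(2) by (simp add: sin_add sin_diff)
  finally show "poly (cheb_U k + 2 * cheb_T (Suc (Suc k))) (cos \<theta>) * sin \<theta>
      = sin ((real (Suc (Suc k)) + 1) * \<theta>)"
    unfolding *(1) .
qed

text \<open>Passing from \<open>d\<close> to \<open>d + 2\<close> adds
  \<open>2 * cheb_T (d + 2)\<close>, which supplies exactly the two new extreme frequencies
  \<open>d + 2\<close> and \<open>- (d + 2)\<close>.\<close>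

lemma cheb_U_cos_fourier: "poly (cheb_U d) (cos \<alpha>) = (\<Sum>j\<le>d. cos ((real d - 2 * real j) * \<alpha>))"
proof (induction d rule: induct_nat_012)
  case 0
  show ?case by (simp add: cheb_U_0)
next
  case 1
  show ?case by (simp add: cheb_U_1)
next
  case (ge2 d)
  have "(\<Sum>j\<le>Suc (Suc d). cos ((real (Suc (Suc d)) - 2 * real j) * \<alpha>))
      = cos (real (Suc (Suc d)) * \<alpha>)
        + (\<Sum>j\<le>Suc d. cos ((real (Suc (Suc d)) - 2 * real (Suc j)) * \<alpha>))"
    by (subst sum.atMost_Suc_shift) simp
  also have "\<dots> = cos (real (Suc (Suc d)) * \<alpha>)
        + ((\<Sum>j\<le>d. cos ((real d - 2 * real j) * \<alpha>)) + cos (- (real (Suc (Suc d)) * \<alpha>)))"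
    by (simp add: algebra_simps)
  finally show ?case
    using ge2(1) by (simp add: cheb_U_eq_add_cheb_T cheb_T_cos del: of_nat_Suc)
qed

text \<open>Differentiating \<open>cos ((d + 1) * \<theta>)\<close> in two ways and cancelling the
  sine gives an antiderivative of \<open>cheb_U d\<close>, from which its integrals along lines
  follow.\<close>

lemma pderiv_cheb_T: "pderiv (cheb_T (Suc d)) = smult (real (Suc d)) (cheb_U d)"
proof (rule poly_eq_on_cos)
  fix \<theta> :: real
  assume s: "sin \<theta> \<noteq> 0"
  have "((\<lambda>\<theta>. poly (cheb_T (Suc d)) (cos \<theta>)) has_real_derivative
      poly (pderiv (cheb_T (Suc d))) (cos \<theta>) * - sin \<theta>) (at \<theta>)"
    by (rule DERIV_chain2[OF poly_DERIV]) (auto intro!: derivative_eq_intros)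
  moreover have "((\<lambda>\<theta>. poly (cheb_T (Suc d)) (cos \<theta>)) has_real_derivative
      - sin (real (Suc d) * \<theta>) * real (Suc d)) (at \<theta>)"
    unfolding cheb_T_cos by (auto intro!: derivative_eq_intros)
  ultimately have "poly (pderiv (cheb_T (Suc d))) (cos \<theta>) * - sin \<theta>
      = - sin (real (Suc d) * \<theta>) * real (Suc d)"
    by (rule DERIV_unique)
  also have "sin (real (Suc d) * \<theta>) = poly (cheb_U d) (cos \<theta>) * sin \<theta>"
    by (simp only: cheb_U_cos_mult_sin of_nat_Suc add.commute)
  finally show "poly (pderiv (cheb_T (Suc d))) (cos \<theta>) = poly (smult (real (Suc d)) (cheb_U d)) (cos \<theta>)"
    using s by simp
qed

section \<open>Radon projections of ridge polynomials\<close>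

lemma integral_cheb_U_line:
  assumes "0 \<le> \<theta>" "\<theta> \<le> pi"
  shows "integral {- sin \<theta>..sin \<theta>} (\<lambda>s. poly (cheb_U d) (cos \<theta> * cos \<alpha> + s * sin \<alpha>))
    = 2 / (real d + 1) * sin ((real d + 1) * \<theta>) * poly (cheb_U d) (cos \<alpha>)"
proof (cases "sin \<alpha> = 0")
  case False
  let ?F = "\<lambda>s. poly (cheb_T (Suc d)) (cos \<theta> * cos \<alpha> + s * sin \<alpha>) / (sin \<alpha> * (real d + 1))"
  have "((\<lambda>s. poly (cheb_U d) (cos \<theta> * cos \<alpha> + s * sin \<alpha>)) has_integral
      ?F (sin \<theta>) - ?F (- sin \<theta>)) {- sin \<theta>..sin \<theta>}"
  proof (rule fundamental_theorem_of_calculus)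
    show "- sin \<theta> \<le> sin \<theta>" using sin_ge_zero[OF assms] by simp
    fix s
    have "((\<lambda>s. poly (cheb_T (Suc d)) (cos \<theta> * cos \<alpha> + s * sin \<alpha>)) has_real_derivative
        poly (pderiv (cheb_T (Suc d))) (cos \<theta> * cos \<alpha> + s * sin \<alpha>) * sin \<alpha>) (at s)"
      by (rule DERIV_chain2[OF poly_DERIV]) (auto intro!: derivative_eq_intros)
    from DERIV_cdivide[OF this, of "sin \<alpha> * (real d + 1)"]
    moreover have "poly (pderiv (cheb_T (Suc d))) (cos \<theta> * cos \<alpha> + s * sin \<alpha>) * sin \<alpha>
        / (sin \<alpha> * (real d + 1)) = poly (cheb_U d) (cos \<theta> * cos \<alpha> + s * sin \<alpha>)"
      using False by (simp add: pderiv_cheb_T add.commute)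
    ultimately have "(?F has_real_derivative poly (cheb_U d) (cos \<theta> * cos \<alpha> + s * sin \<alpha>)) (at s)"
      by (simp only:)
    then show "(?F has_vector_derivative poly (cheb_U d) (cos \<theta> * cos \<alpha> + s * sin \<alpha>))
        (at s within {- sin \<theta>..sin \<theta>})"
      by (simp add: has_real_derivative_iff_has_vector_derivative has_vector_derivative_at_within)
  qed
  \<comment> \<open>At the ends of the chord the addition formulas turn the argument into
    \<open>cos (\<theta> - \<alpha>)\<close> and \<open>cos (\<theta> + \<alpha>)\<close>.\<close>
  then have "integral {- sin \<theta>..sin \<theta>} (\<lambda>s. poly (cheb_U d) (cos \<theta> * cos \<alpha> + s * sin \<alpha>))
      = (poly (cheb_T (Suc d)) (cos (\<theta> - \<alpha>)) - poly (cheb_T (Suc d)) (cos (\<theta> + \<alpha>)))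
        / (sin \<alpha> * (real d + 1))"
    by (simp add: integral_unique cos_add cos_diff diff_divide_distrib)
  also have "poly (cheb_T (Suc d)) (cos (\<theta> - \<alpha>)) - poly (cheb_T (Suc d)) (cos (\<theta> + \<alpha>))
      = 2 * sin ((real d + 1) * \<theta>) * sin ((real d + 1) * \<alpha>)"
    using cos_diff[of "(real d + 1) * \<theta>" "(real d + 1) * \<alpha>"]
      cos_add[of "(real d + 1) * \<theta>" "(real d + 1) * \<alpha>"]
    by (simp add: cheb_T_cos algebra_simps)
  also have "2 * sin ((real d + 1) * \<theta>) * sin ((real d + 1) * \<alpha>) / (sin \<alpha> * (real d + 1))
      = 2 / (real d + 1) * sin ((real d + 1) * \<theta>) * poly (cheb_U d) (cos \<alpha>)"
    using False unfolding cheb_U_cos_mult_sin[symmetric, of d \<alpha>] by simp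
  finally show ?thesis .
next
  case True
  \<comment> \<open>Here the antiderivative would divide by zero, but the integrand is constant
    along the chord. The values of \<open>cheb_U d\<close> at 1 and its parity give the same
    formula.\<close>
  then have "cos \<alpha> = 1 \<or> cos \<alpha> = -1"
    using sin_zero_abs_cos_one by fastforce
  moreover have "poly (cheb_U d) 1 = real d + 1"
    using cheb_U_cos_fourier[of d 0] by simp
  moreover have "poly (cheb_U d) (- u) = (-1) ^ d * poly (cheb_U d) u" for u
    by (induction d rule: induct_nat_012)
      (simp_all add: cheb_U_0 cheb_U_1 cheb_U_rec algebra_simps)
  ultimately have "poly (cheb_U d) (cos \<theta> * cos \<alpha>) * (real d + 1)
      = poly (cheb_U d) (cos \<theta>) * poly (cheb_U d) (cos \<alpha>)"
    by auto
  then show ?thesis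
    using True sin_ge_zero[OF assms] unfolding cheb_U_cos_mult_sin[symmetric]
    by (simp add: field_simps)
qed

text \<open>In coordinates rotated by \<phi> the ridge direction \<eta> becomes
  \<open>\<eta> - \<phi>\<close>, and the chord at distance \<open>cos \<theta>\<close> has half
  length \<open>sin \<theta>\<close>.\<close>

lemma radon_U_ridge:
  assumes "0 \<le> \<theta>" "\<theta> \<le> pi"
  shows "radon \<phi> (U_ridge d \<eta>) (cos \<theta>)
    = 2 / (real d + 1) * sin ((real d + 1) * \<theta>) * poly (cheb_U d) (cos (\<phi> - \<eta>))"
proof -
  have "sqrt (1 - (cos \<theta>)\<^sup>2) = sin \<theta>"
    using sin_ge_zero[OF assms] by (simp add: sin_squared_eq[symmetric])
  moreover have "U_ridge d \<eta> (cos \<theta> * cos \<phi> - s * sin \<phi>) (cos \<theta> * sin \<phi> + s * cos \<phi>)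
      = poly (cheb_U d) (cos \<theta> * cos (\<eta> - \<phi>) + s * sin (\<eta> - \<phi>))" for s
    unfolding U_ridge_def by (simp add: cos_diff sin_diff algebra_simps)
  ultimately show ?thesis
    using integral_cheb_U_line[OF assms, of d "\<eta> - \<phi>"] cos_minus[of "\<eta> - \<phi>"]
    by (simp add: radon_def)
qed

section \<open>Reproduction of trigonometric polynomials at equidistant angles\<close>

text \<open>The free phase \<open>b\<close> covers sines as well as cosines. With closure under
  linear operations built in, a linear identity has to be checked only for single cosines.\<close>

inductive_set trig :: "nat \<Rightarrow> (real \<Rightarrow> real) set" for d where
  cos: "j \<le> d \<Longrightarrow> (\<lambda>\<phi>. cos ((real d - 2 * real j) * \<phi> + b)) \<in> trig d"
| add: "P \<in> trig d \<Longrightarrow> Q \<in> trig d \<Longrightarrow> (\<lambda>\<phi>. P \<phi> + Q \<phi>) \<in> trig d"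
| scale: "P \<in> trig d \<Longrightarrow> (\<lambda>\<phi>. a * P \<phi>) \<in> trig d"

text \<open>The product formula moves a frequency by one in both directions:
  \<open>d - 2 * j\<close> becomes \<open>(d + 1) - 2 * j\<close> and
  \<open>(d + 1) - 2 * (j + 1)\<close>.\<close>

lemma trig_mult_cos:
  assumes "P \<in> trig d"
  shows "(\<lambda>\<phi>. P \<phi> * cos (\<phi> + c)) \<in> trig (Suc d)"
  using assms
proof induction
  case (cos j b)
  have "(\<lambda>\<phi>. (1 / 2) * (cos ((real (Suc d) - 2 * real j) * \<phi> + (b + c))
      + cos ((real (Suc d) - 2 * real (Suc j)) * \<phi> + (b - c)))) \<in> trig (Suc d)"
    using cos by (intro trig.scale trig.add trig.cos) auto
  also have "(\<lambda>\<phi>. (1 / 2) * (cos ((real (Suc d) - 2 * real j) * \<phi> + (b + c))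
      + cos ((real (Suc d) - 2 * real (Suc j)) * \<phi> + (b - c))))
      = (\<lambda>\<phi>. cos ((real d - 2 * real j) * \<phi> + b) * cos (\<phi> + c))"
    by (rule ext, subst cos_times_cos) (simp add: algebra_simps)
  finally show ?case .
next
  case (add P Q)
  then show ?case using trig.add by (fastforce simp: distrib_right)
next
  case (scale P a)
  then show ?case using trig.scale by (fastforce simp: mult.assoc)
qed

lemma trig_Suc_Suc: "P \<in> trig d \<Longrightarrow> P \<in> trig (Suc (Suc d))"
proof (induction rule: trig.induct)
  case (cos j b)
  then show ?case using trig.cos[of "Suc j" "Suc (Suc d)" b] by simp
qed (auto intro: trig.add trig.scale)

text \<open>Induction along the recurrence of \<open>cheb_U\<close>: the factor linear in
  \<open>x\<close>, \<open>y\<close> raises the degree by one, and the term two degrees lower has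
  frequencies of the right parity.\<close>

lemma U_ridge_trig: "(\<lambda>\<phi>. U_ridge d \<phi> x y) \<in> trig d"
proof -
  have mult: "(\<lambda>\<phi>. P \<phi> * (2 * (x * cos \<phi> + y * sin \<phi>))) \<in> trig (Suc e)" if "P \<in> trig e" for P e
  proof -
    have "(\<lambda>\<phi>. (2 * x) * (P \<phi> * cos (\<phi> + 0)) + (2 * y) * (P \<phi> * cos (\<phi> + - (pi / 2)))) \<in> trig (Suc e)"
      by (intro trig.add trig.scale trig_mult_cos that)
    then show ?thesis
      by (simp add: algebra_simps cos_diff)
  qed
  have one: "(\<lambda>\<phi>. 1) \<in> trig 0"
    using trig.cos[of 0 0 0] by simp
  show ?thesis
  proof (induction d rule: induct_nat_012)
    case 0
    show ?case using one by (simp add: U_ridge_def cheb_U_0)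
  next
    case 1
    show ?case using mult[OF one] by (simp add: U_ridge_def cheb_U_1 algebra_simps)
  next
    case (ge2 d)
    have "(\<lambda>\<phi>. U_ridge (Suc d) \<phi> x y * (2 * (x * cos \<phi> + y * sin \<phi>)) + (-1) * U_ridge d \<phi> x y)
        \<in> trig (Suc (Suc d))"
      by (intro trig.add trig.scale mult trig_Suc_Suc ge2)
    then show ?case
      by (simp add: U_ridge_def cheb_U_rec algebra_simps)
  qed
qed

text \<open>Since \<open>N\<close> is odd, 2 is invertible modulo \<open>N\<close>, so the frequency
  \<open>2 * k\<close> is a multiple of \<open>N\<close> only if \<open>k\<close> is.\<close>

lemma sum_cos_even_frequency:
  fixes k :: int
  assumes "odd N" "\<bar>k\<bar> < int N"
  shows "(\<Sum>\<nu><N. cos (2 * of_int k * (2 * pi * real \<nu> / real N) + c)) = (if k = 0 then real N * cos c else 0)"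
proof (cases "k = 0")
  case False
  have "\<not> int N dvd 2 * k"
  proof
    assume "int N dvd 2 * k"
    moreover have "coprime (int N) 2" using assms(1) by simp
    ultimately have "int N dvd \<bar>k\<bar>" by (simp add: coprime_dvd_mult_right_iff)
    then show False using zdvd_imp_le[of "int N" "\<bar>k\<bar>"] False assms(2) by simp
  qed
  from sum_cos_full_period[OF this, of c] show ?thesis
    using False assms by (simp add: algebra_simps)
qed simp

lemma trig_reproducing:
  assumes "odd N" "d < N" "P \<in> trig d"
  shows "(\<Sum>\<nu><N. poly (cheb_U d) (cos (2 * pi * real \<nu> / real N - \<eta>)) * P (2 * pi * real \<nu> / real N))
    = real N * P \<eta>"
  using assms(3)
proof induction
  case (cos i b)
  define \<phi> where "\<phi> \<nu> = 2 * pi * real \<nu> / real N" for \<nu>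
  let ?q = "\<lambda>j. real d - 2 * real j"
  \<comment> \<open>The product of cosines has frequencies \<open>2 * (d - i - j)\<close> and
    \<open>2 * (i - j)\<close>, and a sum survives only at frequency zero. The two terms stay
    separate because \<open>j = i\<close> and \<open>j = d - i\<close> may coincide; either way the
    total over \<open>j\<close> has weight one.\<close>
  have summand: "(\<Sum>\<nu><N. cos (?q j * (\<phi> \<nu> - \<eta>)) * cos (?q i * \<phi> \<nu> + b))
      = (if j = d - i then real N * cos (?q i * \<eta> + b) / 2 else 0)
        + (if j = i then real N * cos (?q i * \<eta> + b) / 2 else 0)" if "j \<le> d" for j
  proof -
    have "(\<Sum>\<nu><N. cos (?q j * (\<phi> \<nu> - \<eta>)) * cos (?q i * \<phi> \<nu> + b))
        = (\<Sum>\<nu><N. cos (2 * of_int (int d - int i - int j) * \<phi> \<nu> + (b - ?q j * \<eta>))) / 2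
          + (\<Sum>\<nu><N. cos (2 * of_int (int i - int j) * \<phi> \<nu> + (- ?q j * \<eta> - b))) / 2"
      unfolding sum.distrib[symmetric] sum_divide_distrib cos_times_cos
      by (rule sum.cong) (simp_all add: algebra_simps add_divide_distrib)
    also have "\<dots> = (if int d - int i - int j = 0 then real N * cos (b - ?q j * \<eta>) else 0) / 2
        + (if int i - int j = 0 then real N * cos (- ?q j * \<eta> - b) else 0) / 2"
      unfolding \<phi>_def
      by (subst (1 2) sum_cos_even_frequency) (use assms cos that in auto)
    also have "\<dots> = (if j = d - i then real N * cos (?q i * \<eta> + b) / 2 else 0)
        + (if j = i then real N * cos (?q i * \<eta> + b) / 2 else 0)"
    proof (intro arg_cong2[of _ _ _ _ "(+)"])
      show "(if int d - int i - int j = 0 then real N * cos (b - ?q j * \<eta>) else 0) / 2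
          = (if j = d - i then real N * cos (?q i * \<eta> + b) / 2 else 0)"
      proof (cases "j = d - i")
        case True
        then have eq: "real j = real d - real i" using cos by simp
        have "b - ?q j * \<eta> = ?q i * \<eta> + b" unfolding eq by (simp add: algebra_simps)
        moreover have "int d - int i - int j = 0" using True cos by simp
        ultimately show ?thesis using True by (simp only: if_True simp_thms)
      qed (use cos in auto)
      have "cos (- ?q i * \<eta> - b) = cos (?q i * \<eta> + b)"
        using cos_minus[of "?q i * \<eta> + b"] by (simp add: algebra_simps)
      then show "(if int i - int j = 0 then real N * cos (- ?q j * \<eta> - b) else 0) / 2
          = (if j = i then real N * cos (?q i * \<eta> + b) / 2 else 0)"
        by auto
    qed
    finally show ?thesis .
  qed
  have "(\<Sum>\<nu><N. poly (cheb_U d) (cos (\<phi> \<nu> - \<eta>)) * cos (?q i * \<phi> \<nu> + b))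
      = (\<Sum>j\<le>d. \<Sum>\<nu><N. cos (?q j * (\<phi> \<nu> - \<eta>)) * cos (?q i * \<phi> \<nu> + b))"
    unfolding cheb_U_cos_fourier sum_distrib_right by (rule sum.swap)
  also have "\<dots> = (\<Sum>j\<le>d. (if j = d - i then real N * cos (?q i * \<eta> + b) / 2 else 0)
        + (if j = i then real N * cos (?q i * \<eta> + b) / 2 else 0))"
    by (rule sum.cong) (simp_all only: summand atMost_iff)
  also have "\<dots> = real N * cos (?q i * \<eta> + b)"
    using cos by (simp add: sum.distrib)
  finally show ?case unfolding \<phi>_def .
next
  case (add P Q)
  then show ?case by (simp add: distrib_left sum.distrib)
next
  case (scale P a)
  then show ?case by (simp add: mult.left_commute[of _ a] sum_distrib_left[symmetric])
qed

section \<open>Gaussian quadrature in the third variable\<close>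

lemma T_tilde_node:
  assumes "L > 0"
  shows "T_tilde L k (z_node L n i)
    = (if k = 0 then 1 else sqrt 2) * cos (real k * ((2 * real i + 1) * pi / (2 * real n)))"
proof -
  have "2 * z_node L n i / L - 1 = cos ((2 * real i + 1) * pi / (2 * real n))"
    using assms by (simp add: z_node_def field_simps)
  then show ?thesis by (simp add: T_tilde_def cheb_T_cos)
qed

text \<open>Exactness of the Gauss rule on a product, obtained from midpoint cosine sums. For
  positive \<open>c = l\<close> the two factors \<open>sqrt 2\<close> offset the one half of the
  product formula.\<close>

lemma T_tilde_discrete_orthonormality:
  assumes "L > 0" "n > 0" "c + l < 2 * n"
  shows "(\<Sum>i<n. T_tilde L c (z_node L n i) * T_tilde L l (z_node L n i)) = (if c = l then real n else 0)"
proof -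
  define w where "w i = (2 * real i + 1) * pi / (2 * real n)" for i
  let ?C = "\<lambda>k::int. \<Sum>i<n. cos (of_int k * w i)"
  let ?s = "\<lambda>k::nat. if k = 0 then 1 else sqrt 2 :: real"
  have "(\<Sum>i<n. T_tilde L c (z_node L n i) * T_tilde L l (z_node L n i))
      = ?s c * ?s l * (\<Sum>i<n. cos (real c * w i) * cos (real l * w i))"
    unfolding T_tilde_node[OF assms(1)] w_def[symmetric] sum_distrib_left by (rule sum.cong) simp_all
  also have "(\<Sum>i<n. cos (real c * w i) * cos (real l * w i))
      = (?C (int c - int l) + ?C (int c + int l)) / 2"
    unfolding sum.distrib[symmetric] sum_divide_distrib cos_times_cos
    by (rule sum.cong) (simp_all add: algebra_simps)
  finally have sum: "(\<Sum>i<n. T_tilde L c (z_node L n i) * T_tilde L l (z_node L n i))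
      = ?s c * ?s l * ((?C (int c - int l) + ?C (int c + int l)) / 2)" .
  have vanish: "?C k = 0" if "k \<noteq> 0" "\<bar>k\<bar> < 2 * int n" for k :: int
    unfolding w_def
  proof (rule sum_cos_midpoint)
    show "\<not> 2 * int n dvd k"
    proof
      assume "2 * int n dvd k"
      then have "2 * int n dvd \<bar>k\<bar>" by simp
      then show False using zdvd_imp_le[of "2 * int n" "\<bar>k\<bar>"] that by simp
    qed
  qed (use assms in simp)
  show ?thesis
  proof (cases "c = l")
    case False
    then have "?C (int c - int l) = 0"
      using assms by (intro vanish) auto
    moreover have "?C (int c + int l) = 0"
      using False assms by (intro vanish) auto
    ultimately show ?thesis using False sum by simp
  next
    case True
    show ?thesis
    proof (cases "c = 0")
      case False
      then have "?C (int c + int l) = 0"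
        using assms by (intro vanish) auto
      with True False sum show ?thesis by simp
    qed (use True sum in simp)
  qed
qed

section \<open>The operator on products of ridge and Chebyshev polynomials\<close>

lemma B_op_basis:
  assumes "L > 0" "n \<ge> 1" "n \<ge> 2 * m" "d + c < 2 * m"
  shows "B_op L m n (\<lambda>x y z. U_ridge d \<eta> x y * T_tilde L c z) x y z = U_ridge d \<eta> x y * T_tilde L c z"
proof -
  define N where "N = 2 * m + 1"
  have N: "2 * real m + 1 = real N" by (simp add: N_def)
  have phi: "phi_angle m \<nu> = 2 * pi * real \<nu> / real N" for \<nu>
    by (simp add: phi_angle_def N)
  have theta: "theta_angle m j = real j * pi / real N" for j
    by (simp add: theta_angle_def N)
  define A where "A \<nu> = poly (cheb_U d) (cos (phi_angle m \<nu> - \<eta>))" for \<nu>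
  define S where "S k j = sin ((real k + 1) * theta_angle m j)" for k j
  define K where "K k = (if c \<le> 2 * m - k then real n * T_tilde L c z else 0)" for k
  have rad: "radon (phi_angle m \<nu>) (\<lambda>u v. U_ridge d \<eta> u v * T_tilde L c z') (cos (theta_angle m j))
      = 2 / (real d + 1) * S d j * A \<nu> * T_tilde L c z'" if "j \<in> {1..2 * m}" for \<nu> j z'
  proof -
    have "0 \<le> theta_angle m j" "theta_angle m j \<le> pi"
      using that mult_right_mono[of "real j" "real N" pi]
      by (auto simp: theta N_def pos_divide_le_eq mult.commute)
    from radon_U_ridge[OF this, of "phi_angle m \<nu>" d \<eta>] show ?thesis
      by (simp add: radon_def A_def S_def)
  qed
  \<comment> \<open>Orthonormality applies since \<open>c < 2 * m\<close>,
    \<open>l \<le> 2 * m\<close> and \<open>n \<ge> 2 * m\<close> give \<open>c + l < 2 * n\<close>.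
    \<open>K k\<close> is zero if the truncation excludes \<open>l = c\<close>.\<close>
  have quad: "(\<Sum>i<n. T_tilde L c (z_node L n i) * (\<Sum>l=0..2*m-k. T_tilde L l (z_node L n i) * T_tilde L l z)) = K k"
    for k
  proof -
    have "(\<Sum>i<n. T_tilde L c (z_node L n i) * (\<Sum>l=0..2*m-k. T_tilde L l (z_node L n i) * T_tilde L l z))
        = (\<Sum>l=0..2*m-k. (\<Sum>i<n. T_tilde L c (z_node L n i) * T_tilde L l (z_node L n i)) * T_tilde L l z)"
      unfolding sum_distrib_left sum_distrib_right by (subst sum.swap) (simp add: mult.assoc)
    also have "\<dots> = (\<Sum>l=0..2*m-k. (if c = l then real n else 0) * T_tilde L l z)"
      by (rule sum.cong) (use assms in \<open>simp_all add: T_tilde_discrete_orthonormality\<close>)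
    also have "\<dots> = K k"
      by (simp add: K_def if_distrib[of "\<lambda>x. x * _"] cong: if_cong)
    finally show ?thesis .
  qed
  have ortho: "(\<Sum>j=1..2*m. S d j * S k j) = (if k = d then real N / 2 else 0)" if "k \<le> 2 * m" for k
  proof -
    \<comment> \<open>The index \<open>j = 0\<close> may be added because the sines vanish
      there.\<close>
    have "(\<Sum>j=1..2*m. S d j * S k j) = (\<Sum>j<N. S d j * S k j)"
      by (rule sum.mono_neutral_left) (auto simp: S_def theta N_def not_le)
    also have "\<dots> = (if Suc d = Suc k then real N / 2 else 0)"
      using sin_discrete_orthogonality[of "Suc d" N "Suc k"] assms that
      by (simp add: S_def theta N_def add.commute)
    finally show ?thesis by auto
  qed
  have inner: "(\<Sum>j=1..2*m. \<Sum>i<n. radon (phi_angle m \<nu>) (\<lambda>u v. U_ridge d \<eta> u v * T_tilde L c (z_node L n i)) (cos (theta_angle m j))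
      * T_kernel L m n \<nu> j i x y z) = A \<nu> * U_ridge d (phi_angle m \<nu>) x y * T_tilde L c z / real N" for \<nu>
  proof -
    define C where "C k = 2 / (real d + 1) * A \<nu> / (real n * (real N)\<^sup>2) * (real k + 1) * U_ridge k (phi_angle m \<nu>) x y" for k
    have "(\<Sum>i<n. radon (phi_angle m \<nu>) (\<lambda>u v. U_ridge d \<eta> u v * T_tilde L c (z_node L n i)) (cos (theta_angle m j))
        * T_kernel L m n \<nu> j i x y z) = (\<Sum>k=0..2*m. C k * K k * (S d j * S k j))" if j: "j \<in> {1..2 * m}" for j
    proof -
      \<comment> \<open>The weight \<open>sin (theta_angle m j)\<close> of \<open>T_kernel\<close>
        joins the value of \<open>cheb_U k\<close> to form \<open>S k j\<close>, matching the
        \<open>S d j\<close> from the projection.\<close>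
      have "radon (phi_angle m \<nu>) (\<lambda>u v. U_ridge d \<eta> u v * T_tilde L c (z_node L n i)) (cos (theta_angle m j))
        * T_kernel L m n \<nu> j i x y z
        = (\<Sum>k=0..2*m. C k * (S d j * S k j) * (T_tilde L c (z_node L n i)
            * (\<Sum>l=0..2*m-k. T_tilde L l (z_node L n i) * T_tilde L l z)))" for i
        unfolding rad[OF j] T_kernel_def Phi_def sum_distrib_left[of _ _ "{0..2*m}"] N
        by (rule sum.cong)
          (simp_all add: C_def S_def cheb_U_cos_mult_sin[symmetric])
      then have "(\<Sum>i<n. radon (phi_angle m \<nu>) (\<lambda>u v. U_ridge d \<eta> u v * T_tilde L c (z_node L n i)) (cos (theta_angle m j))
          * T_kernel L m n \<nu> j i x y z)
        = (\<Sum>k=0..2*m. C k * (S d j * S k j) * (\<Sum>i<n. T_tilde L c (z_node L n i)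
            * (\<Sum>l=0..2*m-k. T_tilde L l (z_node L n i) * T_tilde L l z)))"
        by (simp add: sum_distrib_left[of _ _ "{..<n}"]) (rule sum.swap)
      then show ?thesis
        unfolding quad by (simp add: mult_ac)
    qed
    then have "(\<Sum>j=1..2*m. \<Sum>i<n. radon (phi_angle m \<nu>) (\<lambda>u v. U_ridge d \<eta> u v * T_tilde L c (z_node L n i)) (cos (theta_angle m j))
        * T_kernel L m n \<nu> j i x y z) = (\<Sum>j=1..2*m. \<Sum>k=0..2*m. C k * K k * (S d j * S k j))"
      by (rule sum.cong[OF refl])
    also have "\<dots> = (\<Sum>k=0..2*m. C k * K k * (\<Sum>j=1..2*m. S d j * S k j))"
      unfolding sum_distrib_left by (rule sum.swap)
    also have "\<dots> = (\<Sum>k=0..2*m. C k * K k * (if k = d then real N / 2 else 0))"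
      by (rule sum.cong) (simp_all only: ortho atLeastAtMost_iff)
    also have "\<dots> = C d * K d * (real N / 2)"
      using assms by (simp add: if_distrib[of "\<lambda>x. _ * x"] cong: if_cong)
    also have "K d = real n * T_tilde L c z"
      using assms by (simp add: K_def)
    \<comment> \<open>The constants \<open>2 / (d + 1)\<close>,
      \<open>(d + 1) / (n * N ^ 2)\<close>, \<open>n\<close> and \<open>N / 2\<close> multiply to
      \<open>1 / N\<close>, which the sum over the angles compensates.\<close>
    also have "C d * (real n * T_tilde L c z) * (real N / 2)
        = A \<nu> * U_ridge d (phi_angle m \<nu>) x y * T_tilde L c z / real N"
    proof -
      have "real d + 1 \<noteq> 0" "real n \<noteq> 0" "real N \<noteq> 0"
        using assms by (simp_all add: N_def)
      then show ?thesis by (simp add: C_def power2_eq_square)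
    qed
    finally show ?thesis .
  qed
  have "{0..2*m} = {..<N}" by (auto simp: N_def)
  then have "B_op L m n (\<lambda>x y z. U_ridge d \<eta> x y * T_tilde L c z) x y z
      = (\<Sum>\<nu><N. A \<nu> * U_ridge d (phi_angle m \<nu>) x y) * T_tilde L c z / real N"
    unfolding B_op_def inner by (simp add: sum_divide_distrib sum_distrib_right)
  also have "(\<Sum>\<nu><N. A \<nu> * U_ridge d (phi_angle m \<nu>) x y) = real N * U_ridge d \<eta> x y"
    unfolding A_def phi by (rule trig_reproducing[OF _ _ U_ridge_trig]) (use assms in \<open>simp_all add: N_def\<close>)
  finally show ?thesis by (simp add: N_def)
qed

section \<open>Spanning arguments in spaces of functions\<close>

locale function_subspace =
  fixes V :: "('a \<Rightarrow> real) set"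
  assumes zero: "(\<lambda>p. 0) \<in> V"
    and add: "F \<in> V \<Longrightarrow> G \<in> V \<Longrightarrow> (\<lambda>p. F p + G p) \<in> V"
    and scale: "F \<in> V \<Longrightarrow> (\<lambda>p. a * F p) \<in> V"
begin

lemma sum: "(\<And>i. i \<in> I \<Longrightarrow> F i \<in> V) \<Longrightarrow> (\<lambda>p. \<Sum>i\<in>I. F i p) \<in> V"
  by (induction I rule: infinite_finite_induct) (auto intro: zero add)

text \<open>A Vandermonde argument by elimination: it will extract monomials from the powers of
  \<open>x + t * y\<close>.\<close>

lemma coefficients_mem:
  assumes "\<And>t. (\<lambda>p. \<Sum>j\<le>d. t ^ j * v j p) \<in> V" "j \<le> d"
  shows "v j \<in> V"
  using assms
proof (induction d arbitrary: v j)
  case 0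
  then show ?case using "0.prems"(1)[of 1] by simp
next
  case (Suc d)
  \<comment> \<open>Replacing \<open>q t\<close> by \<open>q (2 * t) - 2 ^ Suc d * q t\<close> removes the leading coefficient.\<close>
  have "(\<lambda>p. \<Sum>i\<le>d. t ^ i * ((2 ^ i - 2 ^ Suc d) * v i p)) \<in> V" for t
  proof -
    have "(\<lambda>p. (\<Sum>i\<le>Suc d. (2 * t) ^ i * v i p) + (- (2 ^ Suc d)) * (\<Sum>i\<le>Suc d. t ^ i * v i p)) \<in> V"
      by (intro add scale Suc.prems)
    also have "(\<lambda>p. (\<Sum>i\<le>Suc d. (2 * t) ^ i * v i p) + (- (2 ^ Suc d)) * (\<Sum>i\<le>Suc d. t ^ i * v i p))
        = (\<lambda>p. \<Sum>i\<le>Suc d. t ^ i * ((2 ^ i - 2 ^ Suc d) * v i p))"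
      unfolding sum_distrib_left sum.distrib[symmetric] by (simp add: power_mult_distrib algebra_simps)
    finally show ?thesis by simp
  qed
  then have scaled: "(\<lambda>p. (2 ^ i - 2 ^ Suc d) * v i p) \<in> V" if "i \<le> d" for i
    using Suc.IH[of "\<lambda>i p. (2 ^ i - 2 ^ Suc d) * v i p" i] that by blast
  have low: "v i \<in> V" if "i \<le> d" for i
  proof -
    have "(2::real) ^ i < 2 ^ Suc d"
      using that by (intro power_strict_increasing) auto
    then have "(2::real) ^ i - 2 ^ Suc d \<noteq> 0" by simp
    then show ?thesis
      using scale[OF scaled[OF that], of "1 / (2 ^ i - 2 ^ Suc d)"] by simp
  qed
  \<comment> \<open>With the lower coefficients known, the leading one is what remains at
    \<open>t = 1\<close>.\<close>
  have "(\<lambda>p. (\<Sum>i\<le>Suc d. 1 ^ i * v i p) + (-1) * (\<Sum>i\<le>d. v i p)) \<in> V"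
    by (intro add scale Suc.prems sum low) simp
  then have "v (Suc d) \<in> V" by simp
  with low Suc.prems(2) show ?case by (cases "j = Suc d") auto
qed

text \<open>Each factor \<open>u\<close> is traded for neighbours of \<open>q k\<close>, so
  \<open>e\<close> drops by one while \<open>k\<close> grows by at most one and \<open>e + k\<close>
  stays within \<open>d\<close>. At \<open>k = 0\<close> the index \<open>k - 1\<close> is again 0,
  which does no harm.\<close>

lemma power_mult_mem:
  assumes recurrence: "\<And>k. \<exists>a b c. \<forall>p. u p * q k p = a * q (Suc k) p + b * q k p + c * q (k - 1) p"
    and "\<And>k. k \<le> d \<Longrightarrow> (\<lambda>p. q k p * w p) \<in> V"
    and "e + k \<le> d"
  shows "(\<lambda>p. u p ^ e * q k p * w p) \<in> V"
  using assms(3)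
proof (induction e arbitrary: k)
  case 0
  then show ?case using assms(2)[of k] by simp
next
  case (Suc e)
  obtain a b c where abc: "\<And>p. u p * q k p = a * q (Suc k) p + b * q k p + c * q (k - 1) p"
    using recurrence by blast
  have "(\<lambda>p. a * (u p ^ e * q (Suc k) p * w p) + b * (u p ^ e * q k p * w p)
      + c * (u p ^ e * q (k - 1) p * w p)) \<in> V"
    using Suc.prems by (intro add scale Suc.IH) auto
  also have "(\<lambda>p. a * (u p ^ e * q (Suc k) p * w p) + b * (u p ^ e * q k p * w p)
      + c * (u p ^ e * q (k - 1) p * w p)) = (\<lambda>p. u p ^ Suc e * q k p * w p)"
  proof
    fix p
    have "u p ^ Suc e * q k p * w p = u p ^ e * (u p * q k p) * w p"
      by (simp add: mult_ac)
    then show "a * (u p ^ e * q (Suc k) p * w p) + b * (u p ^ e * q k p * w p)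
      + c * (u p ^ e * q (k - 1) p * w p) = u p ^ Suc e * q k p * w p"
      unfolding abc by (simp add: algebra_simps)
  qed
  finally show ?case .
qed

end

section \<open>The linear space of reproduced functions\<close>

text \<open>Continuity secures integrability along each chord; \<open>integral\<close> is 0 by
  default on nonintegrable functions and then need not be additive.\<close>

lemma radon_add:
  assumes "continuous_on UNIV (\<lambda>q. g (fst q) (snd q))" "continuous_on UNIV (\<lambda>q. h (fst q) (snd q))"
  shows "radon \<phi> (\<lambda>u v. g u v + h u v) t = radon \<phi> g t + radon \<phi> h t"
proof -
  have "(\<lambda>s. k (t * cos \<phi> - s * sin \<phi>) (t * sin \<phi> + s * cos \<phi>)) integrable_on {a..b}"
    if "continuous_on UNIV (\<lambda>q. k (fst q) (snd q))" for k :: "real \<Rightarrow> real \<Rightarrow> real" and a b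
  proof (rule integrable_continuous_real)
    have "continuous_on {a..b}
        (\<lambda>s. (\<lambda>q. k (fst q) (snd q)) (t * cos \<phi> - s * sin \<phi>, t * sin \<phi> + s * cos \<phi>))"
      by (rule continuous_on_compose2[OF that]) (auto intro!: continuous_intros)
    then show "continuous_on {a..b} (\<lambda>s. k (t * cos \<phi> - s * sin \<phi>) (t * sin \<phi> + s * cos \<phi>))"
      by simp
  qed
  then show ?thesis
    using assms unfolding radon_def by (intro integral_add) blast+
qed

lemma radon_cmult: "radon \<phi> (\<lambda>u v. a * g u v) t = a * radon \<phi> g t"
  by (simp add: radon_def)

text \<open>Continuity of the slices is included so that sums of members satisfy
  \<open>radon_add\<close>.\<close>

definition reproduced :: "real \<Rightarrow> nat \<Rightarrow> nat \<Rightarrow> (real \<times> real \<times> real \<Rightarrow> real) set" where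
  "reproduced L m n = {F. (\<forall>z. continuous_on UNIV (\<lambda>q. F (fst q, snd q, z))) \<and>
     (\<forall>x y z. B_op L m n (\<lambda>x y z. F (x, y, z)) x y z = F (x, y, z))}"

interpretation reproduced: function_subspace "reproduced L m n" for L m n
proof
  show "(\<lambda>p. 0) \<in> reproduced L m n"
    by (simp add: reproduced_def B_op_def radon_def)
next
  fix F G
  assume "F \<in> reproduced L m n" "G \<in> reproduced L m n"
  then have cont: "\<And>z. continuous_on UNIV (\<lambda>q. F (fst q, snd q, z))"
      "\<And>z. continuous_on UNIV (\<lambda>q. G (fst q, snd q, z))"
    and B: "\<And>x y z. B_op L m n (\<lambda>x y z. F (x, y, z)) x y z = F (x, y, z)"
      "\<And>x y z. B_op L m n (\<lambda>x y z. G (x, y, z)) x y z = G (x, y, z)"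
    by (auto simp: reproduced_def)
  have "B_op L m n (\<lambda>x y z. F (x, y, z) + G (x, y, z)) x y z
      = B_op L m n (\<lambda>x y z. F (x, y, z)) x y z + B_op L m n (\<lambda>x y z. G (x, y, z)) x y z" for x y z
    unfolding B_op_def by (simp add: radon_add cont distrib_right sum.distrib)
  then show "(\<lambda>p. F p + G p) \<in> reproduced L m n"
    by (auto simp: reproduced_def B intro!: continuous_on_add cont)
next
  fix F a
  assume "F \<in> reproduced L m n"
  then have cont: "\<And>z. continuous_on UNIV (\<lambda>q. F (fst q, snd q, z))"
    and B: "\<And>x y z. B_op L m n (\<lambda>x y z. F (x, y, z)) x y z = F (x, y, z)"
    by (auto simp: reproduced_def)
  have "B_op L m n (\<lambda>x y z. a * F (x, y, z)) x y z
      = a * B_op L m n (\<lambda>x y z. F (x, y, z)) x y z" for x y z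
    unfolding B_op_def by (simp add: radon_cmult sum_distrib_left mult.assoc)
  then show "(\<lambda>p. a * F p) \<in> reproduced L m n"
    by (auto simp: reproduced_def B intro!: continuous_on_mult_left cont)
qed

section \<open>From the adapted basis to monomials\<close>

lemma T_tilde_recurrence:
  assumes "L > 0"
  shows "\<exists>a b c. \<forall>z. z * T_tilde L k z = a * T_tilde L (Suc k) z + b * T_tilde L k z + c * T_tilde L (k - 1) z"
proof -
  \<comment> \<open>The factor \<open>sqrt 2\<close>, absent only in degree 0, changes the
    coefficients for \<open>k = 0\<close> and \<open>k = 1\<close>.\<close>
  consider "k = 0" | "k = 1" | j where "k = Suc (Suc j)"
    by (metis One_nat_def not0_implies_Suc)
  then show ?thesis
  proof cases
    case 1
    have "z * T_tilde L k z = L / (2 * sqrt 2) * T_tilde L (Suc k) z + L / 2 * T_tilde L k z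
        + 0 * T_tilde L (k - 1) z" for z
      using 1 assms by (simp add: T_tilde_def cheb_T_1 field_simps)
    then show ?thesis by blast
  next
    case 2
    have "z * T_tilde L k z = L / 4 * T_tilde L (Suc k) z + L / 2 * T_tilde L k z
        + L * sqrt 2 / 4 * T_tilde L (k - 1) z" for z
      using 2 assms by (simp add: T_tilde_def cheb_T_0 cheb_T_1 cheb_T_rec field_simps)
    then show ?thesis by blast
  next
    case 3
    have "z * T_tilde L k z = L / 4 * T_tilde L (Suc k) z + L / 2 * T_tilde L k z
        + L / 4 * T_tilde L (k - 1) z" for z
    proof -
      define v where "v = 2 * z / L - 1"
      then have z: "z = L / 2 * (v + 1)"
        using assms by (simp add: field_simps)
      show ?thesis
        unfolding T_tilde_def v_def[symmetric] 3
        by (subst z) (simp add: cheb_T_rec[of "Suc j"] algebra_simps)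
    qed
    then show ?thesis by blast
  qed
qed

lemma cheb_U_recurrence:
  "\<exists>a b c. \<forall>u. u * poly (cheb_U k) u
    = a * poly (cheb_U (Suc k)) u + b * poly (cheb_U k) u + c * poly (cheb_U (k - 1)) u"
proof (cases k)
  case 0
  have "u * poly (cheb_U k) u
      = 1 / 2 * poly (cheb_U (Suc k)) u + 0 * poly (cheb_U k) u + 0 * poly (cheb_U (k - 1)) u" for u
    using 0 by (simp add: cheb_U_0 cheb_U_1)
  then show ?thesis by blast
next
  case (Suc j)
  have "u * poly (cheb_U k) u
      = 1 / 2 * poly (cheb_U (Suc k)) u + 0 * poly (cheb_U k) u + 1 / 2 * poly (cheb_U (k - 1)) u" for u
    using Suc by (simp add: cheb_U_rec algebra_simps)
  then show ?thesis by blast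
qed

lemma basis_reproduced:
  assumes "L > 0" "n \<ge> 1" "n \<ge> 2 * m" "d + c < 2 * m"
  shows "(\<lambda>(x, y, z). U_ridge d \<eta> x y * T_tilde L c z) \<in> reproduced L m n"
proof -
  have "continuous_on UNIV (\<lambda>q. U_ridge d \<eta> (fst q) (snd q) * T_tilde L c z)" for z
    unfolding U_ridge_def by (intro continuous_intros)
  then show ?thesis
    by (simp add: reproduced_def B_op_basis[OF assms])
qed

text \<open>Three conversions in turn: \<open>T_tilde\<close> into powers of \<open>z\<close>,
  \<open>cheb_U\<close> into powers of the ridge variable, and ridge powers in varying directions
  into monomials in \<open>x\<close> and \<open>y\<close>. None raises the degree budget
  \<open>a + b\<close> or \<open>c\<close>.\<close>

lemma monomial_reproduced:
  assumes "L > 0" "n \<ge> 1" "n \<ge> 2 * m" "a + b + c < 2 * m"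
  shows "(\<lambda>(x, y, z). x ^ a * y ^ b * z ^ c) \<in> reproduced L m n"
proof -
  let ?V = "reproduced L m n"
  have ridge_power: "(\<lambda>(x, y, z). U_ridge d \<eta> x y * z ^ c) \<in> ?V" if "d \<le> a + b" for d \<eta>
  proof -
    have "(\<lambda>p. snd (snd p) ^ c * T_tilde L 0 (snd (snd p)) * U_ridge d \<eta> (fst p) (fst (snd p))) \<in> ?V"
    proof (rule reproduced.power_mult_mem[where d = c and q = "\<lambda>k p. T_tilde L k (snd (snd p))"])
      show "\<exists>a b c. \<forall>p. snd (snd p) * T_tilde L k (snd (snd p))
          = a * T_tilde L (Suc k) (snd (snd p)) + b * T_tilde L k (snd (snd p))
            + c * T_tilde L (k - 1) (snd (snd p))" for k
        using T_tilde_recurrence[OF assms(1), of k] by blast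
      show "(\<lambda>p. T_tilde L k (snd (snd p)) * U_ridge d \<eta> (fst p) (fst (snd p))) \<in> ?V" if "k \<le> c" for k
        using basis_reproduced[OF assms(1-3), of d k \<eta>] \<open>d \<le> a + b\<close> that assms(4)
        by (simp add: case_prod_unfold mult.commute)
    qed simp
    then show ?thesis
      by (simp add: T_tilde_def case_prod_unfold mult.commute)
  qed
  have ridge: "(\<lambda>p. (fst p * cos \<eta> + fst (snd p) * sin \<eta>) ^ (a + b) * snd (snd p) ^ c) \<in> ?V" for \<eta>
  proof -
    let ?u = "\<lambda>p::real \<times> real \<times> real. fst p * cos \<eta> + fst (snd p) * sin \<eta>"
    have "(\<lambda>p. ?u p ^ (a + b) * poly (cheb_U 0) (?u p) * snd (snd p) ^ c) \<in> ?V"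
    proof (rule reproduced.power_mult_mem[where d = "a + b" and q = "\<lambda>k p. poly (cheb_U k) (?u p)"])
      show "\<exists>a b c. \<forall>p. ?u p * poly (cheb_U k) (?u p)
          = a * poly (cheb_U (Suc k)) (?u p) + b * poly (cheb_U k) (?u p)
            + c * poly (cheb_U (k - 1)) (?u p)" for k
        using cheb_U_recurrence[of k] by blast
      show "(\<lambda>p. poly (cheb_U k) (?u p) * snd (snd p) ^ c) \<in> ?V" if "k \<le> a + b" for k
        using ridge_power[OF that, of \<eta>] by (simp add: case_prod_unfold U_ridge_def)
    qed simp
    then show ?thesis by (simp add: cheb_U_0)
  qed
  let ?v = "\<lambda>j p. real (a + b choose j) * (fst p ^ (a + b - j) * fst (snd p) ^ j * snd (snd p) ^ c)"
  have "(\<lambda>p. \<Sum>j\<le>a + b. t ^ j * ?v j p) \<in> ?V" for t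
  proof -
    \<comment> \<open>The direction of slope \<open>t\<close>, divided by its positive cosine, turns
      the ridge power into \<open>(x + t * y) ^ (a + b)\<close>, a polynomial in \<open>t\<close>
      with coefficients \<open>?v j\<close>.\<close>
    define r where "r = cos (arctan t)"
    have "r > 0" "sin (arctan t) = t * r"
      by (simp_all add: r_def cos_arctan sin_arctan add_pos_nonneg)
    then have "x * cos (arctan t) + y * sin (arctan t) = r * (t * y + x)" for x y
      by (simp add: r_def algebra_simps)
    with \<open>r > 0\<close> have "1 / r ^ (a + b) * ((x * cos (arctan t) + y * sin (arctan t)) ^ (a + b) * w)
        = (t * y + x) ^ (a + b) * w" for x y w
      by (simp add: power_mult_distrib)
    then have "(\<lambda>p. (t * fst (snd p) + fst p) ^ (a + b) * snd (snd p) ^ c) \<in> ?V"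
      using reproduced.scale[OF ridge[of "arctan t"], of "1 / r ^ (a + b)"] by simp
    then show ?thesis
      unfolding binomial_ring sum_distrib_right by (simp add: power_mult_distrib mult_ac)
  qed
  then have "?v b \<in> ?V"
    by (rule reproduced.coefficients_mem) simp
  from reproduced.scale[OF this, of "1 / real (a + b choose b)"] show ?thesis
    by (simp add: case_prod_unfold)
qed

theorem theorem4p7:
  fixes L :: real and m n :: nat and f :: "real \<Rightarrow> real \<Rightarrow> real \<Rightarrow> real"
  assumes "L > 0"
    and "n \<ge> 1"
    and "n \<ge> 2 * m"
    and "f \<in> poly3 (2 * int m - 1)"
  shows "B_op L m n f = f"
proof -
  obtain coef :: "nat \<Rightarrow> nat \<Rightarrow> nat \<Rightarrow> real" where
    f: "\<And>x y z. f x y z = (\<Sum>(a, b, c) \<in> {(a, b, c). int a + int b + int c \<le> 2 * int m - 1}.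
          coef a b c * x ^ a * y ^ b * z ^ c)"
    using assms(4) unfolding poly3_def by blast
  \<comment> \<open>The integer bound amounts to \<open>a + b + c < 2 * m\<close>. For
    \<open>m = 0\<close> the index set is empty and the sum is the zero function.\<close>
  have "(\<lambda>p. \<Sum>i \<in> {(a, b, c). int a + int b + int c \<le> 2 * int m - 1}.
      (case i of (a, b, c) \<Rightarrow> \<lambda>p. coef a b c * (case p of (x, y, z) \<Rightarrow> x ^ a * y ^ b * z ^ c)) p)
    \<in> reproduced L m n"
    by (rule reproduced.sum)
      (auto intro!: reproduced.scale monomial_reproduced assms(1-3))
  then have "(\<lambda>(x, y, z). f x y z) \<in> reproduced L m n"
    by (simp add: f case_prod_unfold mult.assoc)
  then show ?thesis
    by (intro ext) (simp add: reproduced_def)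
qed

end
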